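(* Let $F\subset[-1,1]^T$ be a nonempty set of static experts and let $\ell(\hat y,y)$ be convex and $L$-Lipschitz in its first argument. Then the relaxation $$\mathbf{Rel}_T(F\mid\partial\ell(\hat y_1,y_1),\dots,\partial\ell(\hat y_t,y_t))=\mathbb E_{\epsilon_{t+1:T}}\sup_{f\in F}\Big[2L\sum_{i=t+1}^T\epsilon_if[i]-\sum_{i=1}^t\partial\ell(\hat y_i,y_i)\cdot f[i]\Big]$$ is admissible with respect to the prediction strategy $$\hat y_t=\mathbb E_\epsilon\Big[\sup_{f\in F}\Big\{\sum_{i=t+1}^T\epsilon_if[i]-\frac1{2L}\sum_{i=1}^{t-1}\partial\ell(\hat y_i,y_i)f[i]+\frac12f[t]\Big\}-\sup_{f\in F}\Big\{\sum_{i=t+1}^T\epsilon_if[i]-\frac1{2L}\sum_{i=1}^{t-1}\partial\ell(\hat y_i,y_i)f[i]-\frac12f[t]\Big\}\Big].$$ Further, the regret of this strategy is bounded as $$\mathbf{Reg}_T\le2L\,\mathbb E_\epsilon\Big[\sup_{f\in F}\sum_{t=1}^T\epsilon_tf[t]\Big].$$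
   Context: Protocol (static experts / transductive online learning): on each round $t=1,\dots,T$ the learner predicts $\hat y_t\in[-1,1]$, observes the outcome $y_t\in[-1,1]$, and suffers $\ell(\hat y_t,y_t)$. $f[t]$ denotes the $t$-th coordinate of $f\in F$. $\partial\ell(\hat y_t,y_t)\in[-L,L]$ denotes a subgradient of $\ell(\cdot,y_t)$ at $\hat y_t$. $\epsilon$'s are i.i.d. Rademacher variables. The problem is reduced to the linearized game in which the learner picks $\hat y_t$, Nature then picks $r_t=\partial\ell(\hat y_t,y_t)\in[-L,L]$, the loss is $r_t\hat y_t$, and the regret is $\mathbf{Reg}_T=\sum_{t=1}^T\partial\ell(\hat y_t,y_t)\hat y_t-\inf_{f\in F}\sum_{t=1}^T\partial\ell(\hat y_t,y_t)f[t]$, which upper bounds $\sum_t\ell(\hat y_t,y_t)-\inf_{f\in F}\sum_t\ell(f[t],y_t)$. Admissible with respect to the strategy means: for every $t$ and history, $\sup_{r_t\in[-L,L]}\{r_t\hat y_t+\mathbf{Rel}_T(F\mid r_1,\dots,r_t)\}\le\mathbf{Rel}_T(F\mid r_1,\dots,r_{t-1})$, and $\mathbf{Rel}_T(F\mid r_1,\dots,r_T)\ge-\inf_{f\in F}\sum_{t=1}^Tr_tf[t]$, where $r_i=\partial\ell(\hat y_i,y_i)$. *)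

theory Defs
  imports "HOL-Probability.Probability"
begin

text \<open>
  Rounds are numbered \<open>0, \<dots>, T - 1\<close>, and an expert is a function on \<open>{..<T}\<close>
  (extensional, so that \<open>{..<T} \<rightarrow>\<^sub>E {-1..1}\<close> is the cube).  The history seen before
  round \<open>t\<close> is the list \<open>[r\<^sub>0, \<dots>, r\<^sub>t\<^sub>-\<^sub>1]\<close> of past subgradients; its length is the
  index of the current round.
  For a nonempty set of experts inside the cube, all suprema and infima over experts
  below are over nonempty bounded sets of reals.
\<close>

definition rademacher :: "nat set \<Rightarrow> (nat \<Rightarrow> real) pmf" where
  "rademacher I = Pi_pmf I 0 (\<lambda>_. pmf_of_set {-1, 1})"

definition rad_expectation :: "nat set \<Rightarrow> ((nat \<Rightarrow> real) \<Rightarrow> real) \<Rightarrow> real" where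
  "rad_expectation I X = measure_pmf.expectation (rademacher I) X"

definition subgradient_on :: "real set \<Rightarrow> (real \<Rightarrow> real) \<Rightarrow> real \<Rightarrow> real \<Rightarrow> bool" where
  "subgradient_on S g x d \<longleftrightarrow> (\<forall>z\<in>S. g x + d * (z - x) \<le> g z)"

definition relaxation :: "real \<Rightarrow> nat \<Rightarrow> (nat \<Rightarrow> real) set \<Rightarrow> real list \<Rightarrow> real" where
  "relaxation L T F h = rad_expectation {length h..<T} (\<lambda>\<epsilon>.
     SUP f\<in>F. 2 * L * (\<Sum>i = length h..<T. \<epsilon> i * f i) - (\<Sum>i<length h. h ! i * f i))"

definition strategy :: "real \<Rightarrow> nat \<Rightarrow> (nat \<Rightarrow> real) set \<Rightarrow> real list \<Rightarrow> real" where
  "strategy L T F h = (let t = length h in rad_expectation {Suc t..<T} (\<lambda>\<epsilon>.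
     (SUP f\<in>F. (\<Sum>i = Suc t..<T. \<epsilon> i * f i)
                - 1 / (2 * L) * (\<Sum>i<t. h ! i * f i) + 1 / 2 * f t)
     - (SUP f\<in>F. (\<Sum>i = Suc t..<T. \<epsilon> i * f i)
                - 1 / (2 * L) * (\<Sum>i<t. h ! i * f i) - 1 / 2 * f t)))"

definition prediction_strategy :: "real \<Rightarrow> nat \<Rightarrow> (real list \<Rightarrow> real) \<Rightarrow> bool" where
  "prediction_strategy L T strat \<longleftrightarrow>
     (\<forall>h. length h < T \<longrightarrow> set h \<subseteq> {-L..L} \<longrightarrow> strat h \<in> {-1..1})"

text \<open>
  The supremum over the next move is taken in the extended reals, because for an
  arbitrary relaxation it may be infinite.
\<close>

definition admissible ::
  "real \<Rightarrow> nat \<Rightarrow> (nat \<Rightarrow> real) set \<Rightarrow> (real list \<Rightarrow> real) \<Rightarrow> (real list \<Rightarrow> real) \<Rightarrow> bool" where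
  "admissible L T F Rel strat \<longleftrightarrow>
     (\<forall>h. length h < T \<longrightarrow> set h \<subseteq> {-L..L} \<longrightarrow>
        (SUP r\<in>{-L..L}. ereal (r * strat h + Rel (h @ [r]))) \<le> ereal (Rel h)) \<and>
     (\<forall>h. length h = T \<longrightarrow> set h \<subseteq> {-L..L} \<longrightarrow>
        Rel h \<ge> - (INF f\<in>F. \<Sum>i<T. h ! i * f i))"

text \<open>
  The sequence \<open>r\<close> is an arbitrary choice, round by round, of subgradients in \<open>[-L, L]\<close> at
  the predictions made by \<open>strat\<close>.  Quantifying over all outcome sequences \<open>y\<close> and all such
  \<open>r\<close> covers adaptive opponents, since the strategy is deterministic.
\<close>

definition play ::
  "(real \<Rightarrow> real \<Rightarrow> real) \<Rightarrow> real \<Rightarrow> nat \<Rightarrow> (real list \<Rightarrow> real) \<Rightarrow> (nat \<Rightarrow> real) \<Rightarrow> (nat \<Rightarrow> real) \<Rightarrow> bool"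
  where
  "play loss L T strat y r \<longleftrightarrow>
     (\<forall>t<T. y t \<in> {-1..1} \<and> r t \<in> {-L..L} \<and>
        subgradient_on {-1..1} (\<lambda>z. loss z (y t)) (strat (map r [0..<t])) (r t))"

definition regret ::
  "nat \<Rightarrow> (nat \<Rightarrow> real) set \<Rightarrow> (real list \<Rightarrow> real) \<Rightarrow> (nat \<Rightarrow> real) \<Rightarrow> real" where
  "regret T F strat r =
     (\<Sum>t<T. r t * strat (map r [0..<t])) - (INF f\<in>F. \<Sum>t<T. r t * f t)"

end

theory Submission
  imports Defs
begin

text \<open>
  For fixed signs of the future rounds, the supremum over experts is a convex and
  \<open>1\<close>-Lipschitz function of the coefficient \<open>c\<close> of the current coordinate \<open>f t\<close>.  Write
  \<open>K c\<close> for it, after scaling by \<open>1 / (2 * L)\<close>.  The strategy predicts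
  \<open>K (1/2) - K (- 1/2)\<close>, the move \<open>r\<close> of Nature leads to \<open>K (- r / (2 * L))\<close>, and averaging over
  the sign of the current round gives \<open>(K 1 + K (-1)) / 2\<close>.  The loss plus the next value is
  convex in \<open>r\<close> and equals \<open>L * (K (1/2) + K (- 1/2))\<close> at both endpoints \<open>r = L\<close> and
  \<open>r = - L\<close>; by convexity this is at most \<open>L * (K 1 + K (-1))\<close>.  The regret bound follows
  by telescoping the admissibility inequalities along the play.
\<close>

section \<open>Suprema of affine functions\<close>

lemma bdd_above_affine:
  fixes g u :: "'a \<Rightarrow> real"
  assumes "bdd_above (g ` A)" and "\<And>x. x \<in> A \<Longrightarrow> \<bar>u x\<bar> \<le> 1"
  shows "bdd_above ((\<lambda>x. g x + c * u x) ` A)"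
proof -
  obtain M where M: "\<And>x. x \<in> A \<Longrightarrow> g x \<le> M"
    using assms(1) by (auto simp: bdd_above_def)
  have "g x + c * u x \<le> M + \<bar>c\<bar>" if "x \<in> A" for x
  proof -
    have "c * u x \<le> \<bar>c\<bar> * \<bar>u x\<bar>"
      by (metis abs_ge_self abs_mult)
    also have "\<dots> \<le> \<bar>c\<bar>"
      using assms(2)[OF that] by (simp add: mult_left_le)
    finally show ?thesis
      using M[OF that] by linarith
  qed
  then show ?thesis
    by (intro bdd_aboveI2)
qed

lemma convex_on_SUP_affine:
  fixes g u :: "'a \<Rightarrow> real"
  assumes "A \<noteq> {}" and "bdd_above (g ` A)" and "\<And>x. x \<in> A \<Longrightarrow> \<bar>u x\<bar> \<le> 1"
  shows "convex_on UNIV (\<lambda>c. SUP x\<in>A. g x + c * u x)"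
proof (rule convex_onI)
  fix s c d :: real
  assume s: "0 < s" "s < 1"
  let ?K = "\<lambda>c. SUP x\<in>A. g x + c * u x"
  have "?K ((1 - s) * c + s * d) \<le> (1 - s) * ?K c + s * ?K d"
  proof (rule cSUP_least[OF assms(1)])
    fix x assume x: "x \<in> A"
    have upper: "g x + b * u x \<le> ?K b" for b
      by (rule cSUP_upper[OF x bdd_above_affine[OF assms(2,3)]])
    have "g x + ((1 - s) * c + s * d) * u x
        = (1 - s) * (g x + c * u x) + s * (g x + d * u x)"
      by (simp add: algebra_simps)
    also have "\<dots> \<le> (1 - s) * ?K c + s * ?K d"
      using s upper by (intro add_mono mult_left_mono) auto
    finally show "g x + ((1 - s) * c + s * d) * u x \<le> (1 - s) * ?K c + s * ?K d" .
  qed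
  then show "?K ((1 - s) *\<^sub>R c + s *\<^sub>R d) \<le> (1 - s) * ?K c + s * ?K d"
    by simp
qed simp

text \<open>Each affine function of the coefficient has slope in \<open>{-1..1}\<close>, and suprema
  inherit the Lipschitz constant. The one-sided form is enough, since \<open>c\<close> and
  \<open>d\<close> may be swapped.\<close>

lemma SUP_affine_diff_le:
  fixes g u :: "'a \<Rightarrow> real"
  assumes "A \<noteq> {}" and "bdd_above (g ` A)" and "\<And>x. x \<in> A \<Longrightarrow> \<bar>u x\<bar> \<le> 1"
  shows "(SUP x\<in>A. g x + c * u x) - (SUP x\<in>A. g x + d * u x) \<le> \<bar>c - d\<bar>"
proof -
  have "(SUP x\<in>A. g x + c * u x) \<le> (SUP x\<in>A. g x + d * u x) + \<bar>c - d\<bar>"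
  proof (rule cSUP_least[OF assms(1)])
    fix x assume x: "x \<in> A"
    have "(c - d) * u x \<le> \<bar>c - d\<bar> * \<bar>u x\<bar>"
      by (metis abs_ge_self abs_mult)
    also have "\<dots> \<le> \<bar>c - d\<bar>"
      using assms(3)[OF x] by (simp add: mult_left_le)
    finally have "g x + c * u x \<le> (g x + d * u x) + \<bar>c - d\<bar>"
      by (simp add: algebra_simps)
    also have "g x + d * u x \<le> (SUP x\<in>A. g x + d * u x)"
      by (rule cSUP_upper[OF x bdd_above_affine[OF assms(2,3)]])
    finally show "g x + c * u x \<le> (SUP x\<in>A. g x + d * u x) + \<bar>c - d\<bar>"
      by simp
  qed
  then show ?thesis by simp
qed

lemma real_SUP_mult_left:
  fixes g :: "'a \<Rightarrow> real"
  assumes "A \<noteq> {}" and "bdd_above (g ` A)" and "0 \<le> c"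
  shows "(SUP x\<in>A. c * g x) = c * (SUP x\<in>A. g x)"
proof -
  have "c * Sup (g ` A) = (SUP y\<in>g ` A. c * y)"
    using assms by (intro continuous_at_Sup_mono) (auto intro!: monoI mult_left_mono continuous_intros)
  then show ?thesis
    by (simp add: image_image)
qed

section \<open>Rademacher expectations\<close>

lemma finite_set_rademacher:
  assumes "finite I"
  shows "finite (set_pmf (rademacher I))"
  using assms by (auto simp: rademacher_def set_Pi_pmf intro!: finite_PiE_dflt)

text \<open>Finite support makes every function integrable, so the suprema over experts need no
  measurability argument.\<close>

lemma integrable_rademacher:
  fixes X :: "(nat \<Rightarrow> real) \<Rightarrow> real"
  assumes "finite I"
  shows "integrable (measure_pmf (rademacher I)) X"
  using finite_set_rademacher[OF assms] by (rule integrable_measure_pmf_finite)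

lemma rad_expectation_mono:
  assumes "finite I" and "\<And>\<epsilon>. X \<epsilon> \<le> Y \<epsilon>"
  shows "rad_expectation I X \<le> rad_expectation I Y"
  unfolding rad_expectation_def
  using assms by (intro integral_mono integrable_rademacher)

lemma rad_expectation_add:
  assumes "finite I"
  shows "rad_expectation I (\<lambda>\<epsilon>. X \<epsilon> + Y \<epsilon>) = rad_expectation I X + rad_expectation I Y"
  unfolding rad_expectation_def
  using assms by (intro Bochner_Integration.integral_add integrable_rademacher)

lemma rad_expectation_mult: "rad_expectation I (\<lambda>\<epsilon>. c * X \<epsilon>) = c * rad_expectation I X"
  by (simp add: rad_expectation_def)

lemma rad_expectation_const: "rad_expectation I (\<lambda>_. c) = c"
  by (simp add: rad_expectation_def)

text \<open>Conditioning on the independent sign \<open>i\<close>, whose two values have weight 1/2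
  each. This peels off the current round from the signs that the relaxation averages over.\<close>

lemma rad_expectation_insert:
  assumes "finite I" and "i \<notin> I"
  shows "rad_expectation (insert i I) X
    = rad_expectation I (\<lambda>\<epsilon>. (X (\<epsilon>(i := 1)) + X (\<epsilon>(i := -1))) / 2)"
proof -
  have "rademacher (insert i I)
      = pmf_of_set {-1, 1} \<bind> (\<lambda>s. map_pmf (\<lambda>\<epsilon>. \<epsilon>(i := s)) (rademacher I))"
    using assms by (simp add: rademacher_def Pi_pmf_insert' map_pmf_def)
  then have "rad_expectation (insert i I) X
      = (\<Sum>s\<in>{-1, 1}. rad_expectation I (\<lambda>\<epsilon>. X (\<epsilon>(i := s))) / 2)"
    using finite_set_rademacher[OF assms(1)]
    by (simp add: rad_expectation_def pmf_expectation_bind_pmf_of_set)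
  then show ?thesis
    using rad_expectation_mult[of I "1/2" "\<lambda>\<epsilon>. X (\<epsilon>(i := 1)) + X (\<epsilon>(i := -1))"]
    by (simp add: rad_expectation_add[OF assms(1)])
qed

section \<open>Admissible relaxations\<close>

lemma regret_le_of_admissible:
  assumes adm: "admissible L T F Rel strat" and r: "\<And>t. t < T \<Longrightarrow> r t \<in> {-L..L}"
  shows "regret T F strat r \<le> Rel []"
proof -
  have hist: "set (map r [0..<t]) \<subseteq> {-L..L}" if "t \<le> T" for t
    using r that by auto
  \<comment> \<open>Invariant: the loss so far plus the current value of the relaxation never
    exceeds its initial value.\<close>
  have "(\<Sum>s<t. r s * strat (map r [0..<s])) + Rel (map r [0..<t]) \<le> Rel []" if "t \<le> T" for t
    using that
  proof (induction t)
    case 0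
    then show ?case by simp
  next
    case (Suc t)
    let ?h = "map r [0..<t]"
    \<comment> \<open>In \<open>ereal\<close> every supremum exists, so the actual move lies below
      it whatever \<open>Rel\<close> is.\<close>
    have "ereal (r t * strat ?h + Rel (?h @ [r t]))
        \<le> (SUP x\<in>{-L..L}. ereal (x * strat ?h + Rel (?h @ [x])))"
      using r Suc.prems by (intro SUP_upper) auto
    also have "\<dots> \<le> ereal (Rel ?h)"
      using adm hist[of t] Suc.prems by (simp add: admissible_def)
    finally show ?case
      using Suc by simp
  qed
  from this[of T]
  have "(\<Sum>t<T. r t * strat (map r [0..<t])) + Rel (map r [0..<T]) \<le> Rel []"
    by simp
  moreover have "- (INF f\<in>F. \<Sum>t<T. r t * f t) \<le> Rel (map r [0..<T])"
  proof -
    have "- (INF f\<in>F. \<Sum>i<T. map r [0..<T] ! i * f i) \<le> Rel (map r [0..<T])"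
      using adm[unfolded admissible_def, THEN conjunct2, rule_format, of "map r [0..<T]"] hist[of T]
      by simp
    then show ?thesis by simp
  qed
  ultimately show ?thesis
    by (simp add: regret_def)
qed

section \<open>Static experts\<close>

locale experts =
  fixes T :: nat and L :: real and F :: "(nat \<Rightarrow> real) set"
  assumes L_pos: "L > 0"
    and F_nonempty: "F \<noteq> {}"
    and F_cube: "F \<subseteq> {..<T} \<rightarrow>\<^sub>E {-1..1}"
begin

lemma abs_expert_le: "f \<in> F \<Longrightarrow> i < T \<Longrightarrow> \<bar>f i\<bar> \<le> 1"
  using F_cube by (fastforce simp: PiE_iff abs_le_iff)

lemma bdd_above_linear:
  assumes "I \<subseteq> {..<T}"
  shows "bdd_above ((\<lambda>f. \<Sum>i\<in>I. c i * f i) ` F)"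
proof (rule bdd_aboveI2)
  fix f assume f: "f \<in> F"
  show "(\<Sum>i\<in>I. c i * f i) \<le> (\<Sum>i\<in>I. \<bar>c i\<bar>)"
  proof (rule sum_mono)
    fix i assume "i \<in> I"
    with assms f have "\<bar>f i\<bar> \<le> 1"
      by (intro abs_expert_le) auto
    then have "\<bar>c i\<bar> * \<bar>f i\<bar> \<le> \<bar>c i\<bar>"
      by (simp add: mult_left_le)
    then show "c i * f i \<le> \<bar>c i\<bar>"
      by (metis abs_ge_self abs_mult order_trans)
  qed
qed

text \<open>The objective without its current coordinate, on the scale of the strategy: the
  coefficient of \<open>f (length h)\<close> is left free to become the argument of
  \<open>K\<close>.\<close>

definition base :: "real list \<Rightarrow> (nat \<Rightarrow> real) \<Rightarrow> (nat \<Rightarrow> real) \<Rightarrow> real" where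
  "base h \<epsilon> f = (\<Sum>i = Suc (length h)..<T. \<epsilon> i * f i) - 1 / (2 * L) * (\<Sum>i<length h. h ! i * f i)"

definition K :: "real list \<Rightarrow> (nat \<Rightarrow> real) \<Rightarrow> real \<Rightarrow> real" where
  "K h \<epsilon> c = (SUP f\<in>F. base h \<epsilon> f + c * f (length h))"

lemma bdd_above_base:
  assumes "length h < T"
  shows "bdd_above (base h \<epsilon> ` F)"
proof -
  \<comment> \<open>Past and future rounds are merged into one linear form over disjoint index
    sets.\<close>
  define c where "c i = (if i < length h then - h ! i / (2 * L) else \<epsilon> i)" for i
  have "base h \<epsilon> f = (\<Sum>i\<in>{Suc (length h)..<T} \<union> {..<length h}. c i * f i)" for f
    by (subst sum.union_disjoint)
       (auto simp: base_def c_def sum_distrib_left sum_negf[symmetric] intro!: sum.cong)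
  moreover have "{Suc (length h)..<T} \<union> {..<length h} \<subseteq> {..<T}"
    using assms by auto
  ultimately show ?thesis
    using bdd_above_linear by presburger
qed

lemma convex_K: "length h < T \<Longrightarrow> convex_on UNIV (K h \<epsilon>)"
  unfolding K_def
  by (rule convex_on_SUP_affine[OF F_nonempty bdd_above_base]) (auto intro: abs_expert_le)

lemma K_diff_le: "length h < T \<Longrightarrow> K h \<epsilon> c - K h \<epsilon> d \<le> \<bar>c - d\<bar>"
  unfolding K_def
  by (rule SUP_affine_diff_le[OF F_nonempty bdd_above_base]) (auto intro: abs_expert_le)

lemma K_scaled:
  assumes "length h < T"
  shows "(SUP f\<in>F. 2 * L * (base h \<epsilon> f + c * f (length h))) = 2 * L * K h \<epsilon> c"
  unfolding K_def
proof (rule real_SUP_mult_left[OF F_nonempty])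
  show "bdd_above ((\<lambda>f. base h \<epsilon> f + c * f (length h)) ` F)"
    by (rule bdd_above_affine[OF bdd_above_base[OF assms]]) (auto intro: abs_expert_le assms)
qed (use L_pos in simp)

lemma strategy_eq:
  "strategy L T F h = rad_expectation {Suc (length h)..<T} (\<lambda>\<epsilon>. K h \<epsilon> (1/2) - K h \<epsilon> (-1/2))"
  by (simp add: strategy_def K_def base_def Let_def)

lemma relaxation_snoc_eq:
  assumes "length h < T"
  shows "relaxation L T F (h @ [r])
    = rad_expectation {Suc (length h)..<T} (\<lambda>\<epsilon>. 2 * L * K h \<epsilon> (- r / (2 * L)))"
proof -
  have "(2 * L * (\<Sum>i = Suc (length h)..<T. \<epsilon> i * f i) - (\<Sum>i<Suc (length h). (h @ [r]) ! i * f i))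
      = 2 * L * (base h \<epsilon> f + (- r / (2 * L)) * f (length h))" for \<epsilon> f
    using L_pos by (simp add: base_def nth_append field_simps)
  then show ?thesis
    by (simp add: relaxation_def flip: K_scaled[OF assms])
qed

lemma relaxation_eq:
  assumes "length h < T"
  shows "relaxation L T F h
    = rad_expectation {Suc (length h)..<T} (\<lambda>\<epsilon>. L * (K h \<epsilon> 1 + K h \<epsilon> (-1)))"
proof -
  have I: "{length h..<T} = insert (length h) {Suc (length h)..<T}"
    using assms by auto
  \<comment> \<open>Updating the sign at \<open>length h\<close> leaves the terms of later rounds
    untouched, so the sign enters only as the coefficient \<open>s\<close>.\<close>
  have "(2 * L * (\<Sum>i = length h..<T. (\<epsilon>(length h := s)) i * f i) - (\<Sum>i<length h. h ! i * f i))
      = 2 * L * (base h \<epsilon> f + s * f (length h))" for \<epsilon> f s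
    unfolding I using L_pos by (simp add: base_def field_simps)
  then have "relaxation L T F h = rad_expectation {Suc (length h)..<T}
      (\<lambda>\<epsilon>. (2 * L * K h \<epsilon> 1 + 2 * L * K h \<epsilon> (-1)) / 2)"
    unfolding relaxation_def K_scaled[OF assms, symmetric]
    by (subst I, subst rad_expectation_insert) simp_all
  then show ?thesis
    by (simp add: add_divide_distrib distrib_left)
qed

text \<open>Stated for each fixed \<open>\<epsilon>\<close>; averaging comes afterwards, since
  \<open>r\<close> does not depend on the future signs.\<close>

lemma step_inequality:
  assumes "length h < T" and r: "r \<in> {-L..L}"
  shows "r * (K h \<epsilon> (1/2) - K h \<epsilon> (-1/2)) + 2 * L * K h \<epsilon> (- r / (2 * L))
    \<le> L * (K h \<epsilon> 1 + K h \<epsilon> (-1))"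
proof -
  have conv: "K h \<epsilon> ((1 - s) * c + s * d) \<le> (1 - s) * K h \<epsilon> c + s * K h \<epsilon> d"
    if "0 \<le> s" "s \<le> 1" for s c d
    using convex_onD[OF convex_K[OF assms(1)], of s c d] that by simp
  \<comment> \<open>The weight that writes \<open>- r / (2 * L)\<close> as a convex combination of
    1/2 (at \<open>r = - L\<close>) and -1/2 (at \<open>r = L\<close>).\<close>
  define s where "s = (L + r) / (2 * L)"
  have "0 \<le> s" "s \<le> 1" and s: "(1 - s) * (1/2) + s * (-1/2) = - r / (2 * L)"
    using L_pos r by (auto simp: s_def field_simps)
  then have "2 * L * K h \<epsilon> (- r / (2 * L))
      \<le> 2 * L * ((1 - s) * K h \<epsilon> (1/2) + s * K h \<epsilon> (-1/2))"
    using conv[of s "1/2" "-1/2"] L_pos by simp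
  \<comment> \<open>The weights scale to \<open>L - r\<close> and \<open>L + r\<close>, so the part
    depending on \<open>r\<close> is exactly what the loss term cancels.\<close>
  also have "\<dots> = L * (K h \<epsilon> (1/2) + K h \<epsilon> (-1/2)) - r * (K h \<epsilon> (1/2) - K h \<epsilon> (-1/2))"
    using L_pos by (simp add: s_def field_simps)
  finally have "r * (K h \<epsilon> (1/2) - K h \<epsilon> (-1/2)) + 2 * L * K h \<epsilon> (- r / (2 * L))
      \<le> L * (K h \<epsilon> (1/2) + K h \<epsilon> (-1/2))"
    by simp
  also have "\<dots> \<le> L * (K h \<epsilon> 1 + K h \<epsilon> (-1))"
    \<comment> \<open>1/2 and -1/2 are combinations of 1 and -1 with weights 3/4, 1/4 and 1/4, 3/4;
      adding the two bounds gives total weight 1 at each endpoint.\<close>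
    using conv[of "1/4" 1 "-1"] conv[of "3/4" 1 "-1"] L_pos by (intro mult_left_mono) simp_all
  finally show ?thesis .
qed

text \<open>The arguments 1/2 and -1/2 are at distance 1 and \<open>K\<close> is 1-Lipschitz, so the
  difference stays in \<open>{-1..1}\<close> for every \<open>\<epsilon>\<close>, hence on
  average.\<close>

lemma prediction_strategy: "prediction_strategy L T (strategy L T F)"
  unfolding prediction_strategy_def
proof (intro allI impI)
  fix h :: "real list"
  assume h: "length h < T"
  let ?I = "{Suc (length h)..<T}"
  have "rad_expectation ?I (\<lambda>\<epsilon>. K h \<epsilon> (1/2) - K h \<epsilon> (-1/2)) \<le> rad_expectation ?I (\<lambda>_. 1)"
    using K_diff_le[OF h, of _ "1/2" "-1/2"] by (intro rad_expectation_mono) simp_all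
  moreover have "rad_expectation ?I (\<lambda>_. -1) \<le> rad_expectation ?I (\<lambda>\<epsilon>. K h \<epsilon> (1/2) - K h \<epsilon> (-1/2))"
  proof (rule rad_expectation_mono)
    show "-1 \<le> K h \<epsilon> (1/2) - K h \<epsilon> (-1/2)" for \<epsilon>
      using K_diff_le[OF h, of \<epsilon> "-1/2" "1/2"] by simp
  qed simp
  ultimately show "strategy L T F h \<in> {-1..1}"
    by (simp add: strategy_eq rad_expectation_const)
qed

text \<open>Prediction and next value average over the same future signs, so linearity combines them
  under one expectation.\<close>

lemma relaxation_step:
  assumes "length h < T" and "r \<in> {-L..L}"
  shows "r * strategy L T F h + relaxation L T F (h @ [r]) \<le> relaxation L T F h"
proof -
  let ?I = "{Suc (length h)..<T}"
  have "r * strategy L T F h + relaxation L T F (h @ [r])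
      = rad_expectation ?I (\<lambda>\<epsilon>. r * (K h \<epsilon> (1/2) - K h \<epsilon> (-1/2)) + 2 * L * K h \<epsilon> (- r / (2 * L)))"
    by (simp only: strategy_eq relaxation_snoc_eq[OF assms(1)] rad_expectation_add
        rad_expectation_mult finite_atLeastLessThan)
  also have "\<dots> \<le> relaxation L T F h"
    unfolding relaxation_eq[OF assms(1)]
    by (intro rad_expectation_mono step_inequality assms) simp
  finally show ?thesis .
qed

text \<open>No signs remain after the last round: the relaxation is the supremum of the negated
  cumulative losses.\<close>

lemma relaxation_final:
  assumes "length h = T"
  shows "- (INF f\<in>F. \<Sum>i<T. h ! i * f i) \<le> relaxation L T F h"
proof -
  have "- (SUP f\<in>F. - (\<Sum>i<T. h ! i * f i)) \<le> (INF f\<in>F. \<Sum>i<T. h ! i * f i)"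
  proof (rule cINF_greatest[OF F_nonempty])
    fix f assume f: "f \<in> F"
    have "bdd_above ((\<lambda>f. - (\<Sum>i<T. h ! i * f i)) ` F)"
      using bdd_above_linear[of "{..<T}" "\<lambda>i. - h ! i"] by (simp add: sum_negf)
    from cSUP_upper[OF f this]
    show "- (SUP f\<in>F. - (\<Sum>i<T. h ! i * f i)) \<le> (\<Sum>i<T. h ! i * f i)"
      by simp
  qed
  then show ?thesis
    using assms by (simp add: relaxation_def rad_expectation_const)
qed

lemma admissible_relaxation: "admissible L T F (relaxation L T F) (strategy L T F)"
  unfolding admissible_def
proof (intro conjI allI impI)
  fix h :: "real list"
  assume "length h < T"
  then show "(SUP r\<in>{-L..L}. ereal (r * strategy L T F h + relaxation L T F (h @ [r])))
      \<le> ereal (relaxation L T F h)"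
    by (intro SUP_least) (simp add: relaxation_step)
qed (rule relaxation_final)

lemma relaxation_Nil_eq:
  "relaxation L T F [] = 2 * L * rad_expectation {..<T} (\<lambda>\<epsilon>. SUP f\<in>F. \<Sum>t<T. \<epsilon> t * f t)"
proof -
  have "(SUP f\<in>F. 2 * L * (\<Sum>t<T. \<epsilon> t * f t)) = 2 * L * (SUP f\<in>F. \<Sum>t<T. \<epsilon> t * f t)" for \<epsilon>
    using L_pos by (intro real_SUP_mult_left F_nonempty bdd_above_linear) auto
  then show ?thesis
    by (simp add: relaxation_def atLeast0LessThan flip: rad_expectation_mult)
qed

end

theorem lemma19:
  fixes T :: nat and L :: real and F :: "(nat \<Rightarrow> real) set"
    and loss :: "real \<Rightarrow> real \<Rightarrow> real"
  assumes "L > 0"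
    and "F \<noteq> {}"
    and "F \<subseteq> {..<T} \<rightarrow>\<^sub>E {-1..1}"
    and "\<And>y. y \<in> {-1..1} \<Longrightarrow> convex_on {-1..1} (\<lambda>z. loss z y)"
    and "\<And>y. y \<in> {-1..1} \<Longrightarrow> L-lipschitz_on {-1..1} (\<lambda>z. loss z y)"
  shows "prediction_strategy L T (strategy L T F) \<and>
         admissible L T F (relaxation L T F) (strategy L T F) \<and>
         (\<forall>y r. play loss L T (strategy L T F) y r \<longrightarrow>
            regret T F (strategy L T F) r
              \<le> 2 * L * rad_expectation {..<T} (\<lambda>\<epsilon>. SUP f\<in>F. \<Sum>t<T. \<epsilon> t * f t))"
proof -
  interpret experts T L F
    using assms(1-3) by unfold_locales
  have "regret T F (strategy L T F) r \<le> relaxation L T F []"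
    if "play loss L T (strategy L T F) y r" for y r
    using that by (intro regret_le_of_admissible[OF admissible_relaxation]) (simp add: play_def)
  then show ?thesis
    using prediction_strategy admissible_relaxation relaxation_Nil_eq by auto
qed

end
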